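(* Let $x_1,x_2,x_3,x_4\in\mathbb R^3$ be four distinct points which are the consecutive vertices of a parallelogram, with side lengths $r_{12}=r_{34}=a$, $r_{23}=r_{14}=b$ and diagonals $r_{24}=e$, $r_{13}=f$. Then the following hold. (C2) $|D_4|\ge 64\prod_{1\le i<j\le 4}r_{ij}$. (C3) $|D_4|^2\ge \prod_{\{i<j<k\}\subset\{1,2,3,4\}}\bigl(d_3(r_{ij},r_{ik},r_{jk})+8r_{ij}r_{ik}r_{jk}\bigr)$. (Strong Four Points inequality; here $V=0$) $$\Re(D_4)\ \ge\ 64\prod_{1\le i<j\le 4}r_{ij}+\sum_{l=1}^4\Bigl(4+\tfrac14\Bigr)r_{il}r_{jl}r_{kl}\,d_3(r_{ij},r_{ik},r_{jk}),$$ where for each $l$ one writes $\{1,2,3,4\}\setminus\{l\}=\{i<j<k\}$.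
   Context: Put $d_3(a,b,c)=(a+b-c)(b+c-a)(c+a-b)$. For distinct points $x_1,\dots,x_4\in\mathbb R^3$ let $r_{ij}=|x_i-x_j|$, and let $V$ be the volume of the tetrahedron with these vertices ($V=0$ if coplanar). The (non-normalized) Atiyah determinant $D_4\in\mathbb C$ is defined as follows. Identify $S^2$ with $\mathbb{CP}^1=\mathbb C\cup\{\infty\}$ by stereographic projection, so that the antipode of $t$ is $-1/\bar t$. For $i\ne j$ let $t_{ij}$ be the point corresponding to the unit vector $(x_j-x_i)/r_{ij}$. For each pair $i<j$ choose a unit vector $(\alpha,\beta)\in\mathbb C^2$ such that $\ell_{ij}(t)=\alpha t+\beta$ has root $t_{ij}$ (with $\alpha=0$ if $t_{ij}=\infty$), and put $\ell_{ji}(t)=-\bar\beta t+\bar\alpha$ (which has root $t_{ji}$). Let $p_i(t)=\prod_{j\ne i}\ell_{ij}(t)=\sum_{j=1}^4 m_{ij}t^{j-1}$ and $D_4=64\prod_{1\le i<j\le4}r_{ij}\cdot\det(m_{ij})$; this does not depend on the choices. Known fact (Eastwood–Norbury): $$\Re(D_4)=64\prod_{i<j}r_{ij}-4d_3(r_{12}r_{34},r_{13}r_{24},r_{14}r_{23})+A_4+288V^2,$$ $$A_4=\sum_{l=1}^4\Bigl(\sum_{i\ne l}r_{li}\bigl((r_{lj}+r_{lk})^2-r_{jk}^2\bigr)\Bigr)d_3(r_{ij},r_{ik},r_{jk}),\qquad \{j,k\}=\{1,2,3,4\}\setminus\{l,i\},$$ and $D_4$ is real when the four points are coplanar. *)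

theory Defs
  imports "HOL-Analysis.Analysis" "HOL-Computational_Algebra.Polynomial"
begin

definition d3 :: "real \<Rightarrow> real \<Rightarrow> real \<Rightarrow> real" where
  "d3 a b c = (a + b - c) * (b + c - a) * (c + a - b)"

text \<open>
  The four points are \<open>x 1, x 2, x 3, x 4\<close>; the values of \<open>x\<close> outside \<open>{1..4}\<close> are irrelevant.
\<close>

abbreviation pdist :: "(nat \<Rightarrow> real^3) \<Rightarrow> nat \<Rightarrow> nat \<Rightarrow> real" where
  "pdist x i j \<equiv> dist (x i) (x j)"

abbreviation pairs4 :: "(nat \<times> nat) set" where
  "pairs4 \<equiv> {(i, j). 1 \<le> i \<and> i < j \<and> j \<le> 4}"

abbreviation triples4 :: "(nat \<times> nat \<times> nat) set" where
  "triples4 \<equiv> {(i, j, k). 1 \<le> i \<and> i < j \<and> j < k \<and> k \<le> 4}"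

text \<open>
  Stereographic projection from the north pole, with values in the Riemann sphere; \<open>None\<close> is the
  point at infinity. The lemma \<open>stereo_antipode\<close> below checks the antipode convention.
\<close>

definition stereo :: "real^3 \<Rightarrow> complex option" where
  "stereo u = (if u $ 3 = 1 then None
     else Some (Complex (u $ 1) (u $ 2) / complex_of_real (1 - u $ 3)))"

definition direction :: "real^3 \<Rightarrow> real^3 \<Rightarrow> real^3" where
  "direction p q = (q - p) /\<^sub>R dist p q"

definition atiyah_choice ::
  "(nat \<Rightarrow> real^3) \<Rightarrow> (nat \<Rightarrow> nat \<Rightarrow> complex) \<Rightarrow> (nat \<Rightarrow> nat \<Rightarrow> complex) \<Rightarrow> bool" where
  "atiyah_choice x \<alpha> \<beta> \<longleftrightarrow>
     (\<forall>(i, j) \<in> pairs4.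
        (cmod (\<alpha> i j))\<^sup>2 + (cmod (\<beta> i j))\<^sup>2 = 1 \<and>
        (case stereo (direction (x i) (x j)) of
           None \<Rightarrow> \<alpha> i j = 0
         | Some t \<Rightarrow> \<alpha> i j * t + \<beta> i j = 0))"

text \<open>Only the values of \<open>\<alpha>\<close> and \<open>\<beta>\<close> at pairs \<open>i < j\<close> are used.\<close>

definition atiyah_lin ::
  "(nat \<Rightarrow> nat \<Rightarrow> complex) \<Rightarrow> (nat \<Rightarrow> nat \<Rightarrow> complex) \<Rightarrow> nat \<Rightarrow> nat \<Rightarrow> complex poly" where
  "atiyah_lin \<alpha> \<beta> i j =
     (if i < j then [:\<beta> i j, \<alpha> i j:] else [:cnj (\<alpha> j i), - cnj (\<beta> j i):])"

definition atiyah_poly ::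
  "(nat \<Rightarrow> nat \<Rightarrow> complex) \<Rightarrow> (nat \<Rightarrow> nat \<Rightarrow> complex) \<Rightarrow> nat \<Rightarrow> complex poly" where
  "atiyah_poly \<alpha> \<beta> i = (\<Prod>j \<in> {1..4} - {i}. atiyah_lin \<alpha> \<beta> i j)"

text \<open>
  Row \<open>i\<close> lists the coefficients of \<open>1, t, t\<^sup>2, t\<^sup>3\<close> in the \<open>i\<close>-th polynomial.
  In the index type \<open>4\<close> we have \<open>4 = 0\<close>; \<open>vector\<close> puts the \<open>n\<close>-th list entry at index \<open>n\<close>, for rows and
  columns alike, so the determinant has the usual sign.
\<close>

definition atiyah_matrix ::
  "(nat \<Rightarrow> nat \<Rightarrow> complex) \<Rightarrow> (nat \<Rightarrow> nat \<Rightarrow> complex) \<Rightarrow> complex^4^4" where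
  "atiyah_matrix \<alpha> \<beta> =
     vector (map (\<lambda>i. vector (map (\<lambda>j. coeff (atiyah_poly \<alpha> \<beta> i) (j - 1)) [1, 2, 3, 4])) [1, 2, 3, 4])"

definition D4 ::
  "(nat \<Rightarrow> real^3) \<Rightarrow> (nat \<Rightarrow> nat \<Rightarrow> complex) \<Rightarrow> (nat \<Rightarrow> nat \<Rightarrow> complex) \<Rightarrow> complex" where
  "D4 x \<alpha> \<beta> =
     complex_of_real (64 * (\<Prod>(i, j) \<in> pairs4. pdist x i j)) * det (atiyah_matrix \<alpha> \<beta>)"

text \<open>Collinear (degenerate) parallelograms are included.\<close>

definition parallelogram :: "'a::real_vector \<Rightarrow> 'a \<Rightarrow> 'a \<Rightarrow> 'a \<Rightarrow> bool" where
  "parallelogram p q r s \<longleftrightarrow> q - p = r - s"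

lemma stereo_antipode:
  assumes "norm u = 1" "stereo u = Some t" "t \<noteq> 0"
  shows "stereo (- u) = Some (- 1 / cnj t)"
proof -
  have n: "(u$1)\<^sup>2 + (u$2)\<^sup>2 + (u$3)\<^sup>2 = 1"
    using assms(1) by (simp add: norm_eq_1 inner_vec_def sum_3 power2_eq_square)
  have u3: "u $ 3 \<noteq> 1" and t: "t = Complex (u$1) (u$2) / complex_of_real (1 - u$3)"
    using assms(2) by (auto simp: stereo_def split: if_splits)
  have z: "Complex (u$1) (u$2) \<noteq> 0" using t assms(3) by auto
  have u3': "u $ 3 \<noteq> - 1"
  proof
    assume "u $ 3 = - 1"
    then have "(u$1)\<^sup>2 + (u$2)\<^sup>2 = 0" using n by simp
    then show False using z by (simp add: complex_eq_iff sum_power2_eq_zero_iff)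
  qed
  let ?z = "Complex (u$1) (u$2)"
  have zz: "?z * cnj ?z = complex_of_real ((1 - u$3) * (1 + u$3))"
    using n by (simp add: complex_eq_iff power2_eq_square algebra_simps)
  have "- ?z / complex_of_real (1 + u$3) = - 1 / cnj t"
  proof -
    have a: "complex_of_real (1 + u$3) \<noteq> 0" "complex_of_real (1 - u$3) \<noteq> 0"
      using u3 u3' by (auto simp: complex_eq_iff)
    have "cnj t = cnj ?z / complex_of_real (1 - u$3)" by (simp add: t)
    then have "?z * cnj t = complex_of_real (1 + u$3)" using zz a by simp
    moreover have "cnj t \<noteq> 0" using assms(3) by simp
    ultimately show ?thesis using a(1) by (simp add: divide_eq_eq eq_divide_eq)
  qed
  moreover have "Complex (- (u$1)) (- (u$2)) = - ?z" by (simp add: complex_eq_iff)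
  moreover have "- (u$3) \<noteq> 1" using u3' by linarith
  ultimately show ?thesis by (simp add: stereo_def)
qed

text \<open>
  A normalized choice of linear forms always exists, so a statement about all choices is not vacuous.
\<close>

lemma atiyah_choice_exists: "\<exists>\<alpha> \<beta>. atiyah_choice x \<alpha> \<beta>"
proof -
  have ex: "\<exists>a b. (cmod a)\<^sup>2 + (cmod b)\<^sup>2 = 1 \<and>
      (case s of None \<Rightarrow> a = 0 | Some t \<Rightarrow> a * t + b = 0)" for s
  proof (cases s)
    case None
    then show ?thesis by (intro exI[of _ 0] exI[of _ 1]) auto
  next
    case (Some t)
    define n where "n = sqrt (1 + (cmod t)\<^sup>2)"
    have n: "n\<^sup>2 = 1 + (cmod t)\<^sup>2" unfolding n_def by simp
    then have n0: "n \<noteq> 0" by (smt (verit) power_zero_numeral zero_le_power2)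
    have "(cmod (1 / complex_of_real n))\<^sup>2 + (cmod (- t / complex_of_real n))\<^sup>2 = 1"
      using n0 by (simp add: norm_divide power_divide n[symmetric] flip: add_divide_distrib)
    then show ?thesis
      using Some by (intro exI[of _ "1 / complex_of_real n"] exI[of _ "- t / complex_of_real n"]) auto
  qed
  then have "\<forall>i j. \<exists>a b. (cmod a)\<^sup>2 + (cmod b)\<^sup>2 = 1 \<and>
      (case stereo (direction (x i) (x j)) of None \<Rightarrow> a = 0 | Some t \<Rightarrow> a * t + b = 0)"
    by blast
  then show ?thesis unfolding atiyah_choice_def by (auto simp: choice_iff)
qed

end

(*
  A direction in R^3 is a unit spinor up to phase. All directions between vertices of a parallelogram
  lie in one plane, so in a suitable unitary frame (F, J F) of C^2 they are phases times real
  combinations c F + s J F. The phases cancel in the determinant, the change of frame has determinant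
  one on cubic forms, and what remains is a real 4x4 determinant in half-angle sines and cosines,
  which is a sum of two squares. Expressed through the sides it gives
    D_4 = 64 a^2 b^2 e f + 8 a b T (2 p^2 + 2 p (e + f) + e f + q^2),
  where p = a + b, q = a - b and T = (p - e)(p - f) >= 0. The law e^2 + f^2 = p^2 + q^2 makes T a
  factor of the right-hand sides as well, and what is left of the inequalities is elementary.
*)
theory Submission
  imports Defs
begin

section \<open>Determinants and vectors of size four in coordinates\<close>

lemma det_4:
  fixes A :: "'a::comm_ring_1^4^4"
  shows "det A =
    A$1$1 * (A$2$2 * (A$3$3 * A$4$4 - A$3$4 * A$4$3) - A$2$3 * (A$3$2 * A$4$4 - A$3$4 * A$4$2)
           + A$2$4 * (A$3$2 * A$4$3 - A$3$3 * A$4$2))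
  - A$1$2 * (A$2$1 * (A$3$3 * A$4$4 - A$3$4 * A$4$3) - A$2$3 * (A$3$1 * A$4$4 - A$3$4 * A$4$1)
           + A$2$4 * (A$3$1 * A$4$3 - A$3$3 * A$4$1))
  + A$1$3 * (A$2$1 * (A$3$2 * A$4$4 - A$3$4 * A$4$2) - A$2$2 * (A$3$1 * A$4$4 - A$3$4 * A$4$1)
           + A$2$4 * (A$3$1 * A$4$2 - A$3$2 * A$4$1))
  - A$1$4 * (A$2$1 * (A$3$2 * A$4$3 - A$3$3 * A$4$2) - A$2$2 * (A$3$1 * A$4$3 - A$3$3 * A$4$1)
           + A$2$3 * (A$3$1 * A$4$2 - A$3$2 * A$4$1))"
proof -
  have f: "finite {2::4, 3, 4}" "1 \<notin> {2::4, 3, 4}" "finite {3::4, 4}" "2 \<notin> {3::4, 4}"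
    "finite {4::4}" "3 \<notin> {4::4}"
    by auto
  show ?thesis
    unfolding det_def UNIV_4
    unfolding sum_over_permutations_insert[OF f(1,2)]
    unfolding sum_over_permutations_insert[OF f(3,4)]
    unfolding sum_over_permutations_insert[OF f(5,6)]
    unfolding permutes_sing
    apply (simp add: sign_swap_id permutation_swap_id sign_compose sign_id permutation_compose swap_id_eq)
    by (simp add: algebra_simps)
qed

lemma vector_4 [simp]:
  "(vector [a, b, c, d] :: 'a::zero^4) $ 1 = a"
  "(vector [a, b, c, d] :: 'a::zero^4) $ 2 = b"
  "(vector [a, b, c, d] :: 'a::zero^4) $ 3 = c"
  "(vector [a, b, c, d] :: 'a::zero^4) $ 4 = d"
  unfolding vector_def by simp_all

section \<open>Unit spinors and the directions they represent\<close>

text \<open>The unit vector whose stereographic projection is the root of \<open>\<alpha> t + \<beta>\<close>.\<close>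

definition hopf :: "complex \<Rightarrow> complex \<Rightarrow> real^3" where
  "hopf \<alpha> \<beta> = vector [Re (- 2 * \<beta> * cnj \<alpha>), Im (- 2 * \<beta> * cnj \<alpha>), (cmod \<beta>)\<^sup>2 - (cmod \<alpha>)\<^sup>2]"

text \<open>
  The direction of the spinor \<open>(F + J F) / sqrt 2\<close> for \<open>F = (\<alpha>, \<beta>)\<close> and \<open>J F = (- cnj \<beta>, cnj \<alpha>)\<close>; together
  with \<open>hopf \<alpha> \<beta>\<close> it spans the plane of directions of the real combinations of \<open>F\<close> and \<open>J F\<close>.
\<close>

definition conormal :: "complex \<Rightarrow> complex \<Rightarrow> real^3" where
  "conormal \<alpha> \<beta> = vector [Re (\<beta>\<^sup>2 - (cnj \<alpha>)\<^sup>2), Im (\<beta>\<^sup>2 - (cnj \<alpha>)\<^sup>2), 2 * Re (\<alpha> * \<beta>)]"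

definition unit_spinor :: "complex \<Rightarrow> complex \<Rightarrow> bool" where
  "unit_spinor \<alpha> \<beta> \<longleftrightarrow> (cmod \<alpha>)\<^sup>2 + (cmod \<beta>)\<^sup>2 = 1"

lemma unit_spinor_iff: "unit_spinor \<alpha> \<beta> \<longleftrightarrow> \<alpha> * cnj \<alpha> + \<beta> * cnj \<beta> = 1"
proof -
  have "\<alpha> * cnj \<alpha> + \<beta> * cnj \<beta> = complex_of_real ((cmod \<alpha>)\<^sup>2 + (cmod \<beta>)\<^sup>2)"
    by (simp only: of_real_add complex_norm_square)
  then show ?thesis by (simp only: unit_spinor_def of_real_eq_1_iff)
qed

text \<open>Put \<open>z = u_1 + i u_2\<close> and \<open>w = 1 - u_3\<close>. The root condition
  reads \<open>\<beta> w = - \<alpha> z\<close> and the sphere equation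
  \<open>|z|^2 = w (2 - w)\<close>; comparing squared moduli under the normalization forces
  \<open>2 |\<alpha>|^2 = w\<close>, which fixes all three coordinates. The pole
  \<open>w = 0\<close> is the case \<open>\<alpha> = 0\<close>.\<close>

lemma hopf_stereo:
  assumes "norm u = 1" "unit_spinor \<alpha> \<beta>"
    and "case stereo u of None \<Rightarrow> \<alpha> = 0 | Some t \<Rightarrow> \<alpha> * t + \<beta> = 0"
  shows "hopf \<alpha> \<beta> = u"
proof -
  have n: "(u$1)\<^sup>2 + (u$2)\<^sup>2 + (u$3)\<^sup>2 = 1"
    using assms(1) by (simp add: norm_eq_1 inner_vec_def sum_3 power2_eq_square)
  have ab: "(cmod \<alpha>)\<^sup>2 + (cmod \<beta>)\<^sup>2 = 1" using assms(2) by (simp add: unit_spinor_def)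
  show ?thesis
  proof (cases "u $ 3 = 1")
    case True
    then have "\<alpha> = 0" using assms(3) by (simp add: stereo_def)
    moreover have "u $ 1 = 0" "u $ 2 = 0" using n True by (simp_all add: sum_power2_eq_zero_iff)
    ultimately show ?thesis using ab True by (simp add: hopf_def vec_eq_iff forall_3)
  next
    case False
    define w where "w = 1 - u $ 3"
    have w0: "w \<noteq> 0" using False by (simp add: w_def)
    have "\<beta> = - \<alpha> * (Complex (u$1) (u$2) / complex_of_real w)"
      using assms(3) False by (simp add: stereo_def w_def eq_neg_iff_add_eq_0 add.commute)
    then have b: "\<beta> * w = - \<alpha> * Complex (u$1) (u$2)" using w0 by simp
    have zz: "(u$1)\<^sup>2 + (u$2)\<^sup>2 = w * (2 - w)" using n by (simp add: w_def power2_eq_square algebra_simps)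
    have "(cmod \<beta>)\<^sup>2 * w\<^sup>2 = (cmod \<alpha>)\<^sup>2 * ((u$1)\<^sup>2 + (u$2)\<^sup>2)"
      using arg_cong[OF b, of "\<lambda>z. (cmod z)\<^sup>2"]
      by (simp add: norm_mult power_mult_distrib cmod_power2)
    then have "(cmod \<beta>)\<^sup>2 * w = (cmod \<alpha>)\<^sup>2 * (2 - w)"
      using w0 unfolding zz by (simp add: power2_eq_square)
    then have a2: "2 * (cmod \<alpha>)\<^sup>2 = w" using ab by algebra
    then have a3: "2 * (\<alpha> * cnj \<alpha>) = w"
      unfolding a2[symmetric] by (simp only: of_real_mult complex_norm_square of_real_numeral)
    have "(- 2 * \<beta> * cnj \<alpha>) * w = - 2 * cnj \<alpha> * (\<beta> * w)" by (simp add: ac_simps)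
    also have "\<dots> = 2 * (\<alpha> * cnj \<alpha>) * Complex (u$1) (u$2)" unfolding b by (simp add: ac_simps)
    finally have "(- 2 * \<beta> * cnj \<alpha>) * w = Complex (u$1) (u$2) * w"
      unfolding a3 by (simp only: mult.commute)
    then have "- 2 * \<beta> * cnj \<alpha> = Complex (u$1) (u$2)"
      using w0 by (simp only: mult_cancel_right of_real_eq_0_iff) simp
    moreover have "(cmod \<beta>)\<^sup>2 - (cmod \<alpha>)\<^sup>2 = u $ 3" using a2 ab w_def by linarith
    ultimately show ?thesis by (simp only: hopf_def vec_eq_iff forall_3 vector_3 complex.sel)
  qed
qed

text \<open>For a unit spinor the direction determines \<open>\<beta> cnj \<alpha>\<close>,
  \<open>|\<alpha>|^2\<close> and \<open>|\<beta>|^2\<close>, hence the orthogonal projection onto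
  its complex line. Two unit vectors on one complex line differ by a phase.\<close>

lemma hopf_eq_imp_phase:
  assumes "unit_spinor \<alpha> \<beta>" "unit_spinor \<alpha>' \<beta>'" "hopf \<alpha>' \<beta>' = hopf \<alpha> \<beta>"
  obtains \<omega> where "\<omega> * cnj \<omega> = 1" "\<alpha>' = \<omega> * \<alpha>" "\<beta>' = \<omega> * \<beta>"
proof -
  have "- 2 * \<beta>' * cnj \<alpha>' = - 2 * \<beta> * cnj \<alpha>"
    using assms(3) by (simp only: hopf_def vec_eq_iff forall_3 vector_3 complex_eq_iff)
  then have 1: "\<beta>' * cnj \<alpha>' = \<beta> * cnj \<alpha>" by simp
  have 2: "cnj \<beta>' * \<alpha>' = cnj \<beta> * \<alpha>" using arg_cong[OF 1, of cnj] by simp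
  have "(cmod \<beta>')\<^sup>2 - (cmod \<alpha>')\<^sup>2 = (cmod \<beta>)\<^sup>2 - (cmod \<alpha>)\<^sup>2"
    using assms(3) by (simp only: hopf_def vec_eq_iff forall_3 vector_3)
  then have "(cmod \<beta>')\<^sup>2 = (cmod \<beta>)\<^sup>2" "(cmod \<alpha>')\<^sup>2 = (cmod \<alpha>)\<^sup>2"
    using assms(1,2) unfolding unit_spinor_def by linarith+
  then have 3: "\<beta>' * cnj \<beta>' = \<beta> * cnj \<beta>" "\<alpha>' * cnj \<alpha>' = \<alpha> * cnj \<alpha>"
    by (simp_all add: complex_norm_square[symmetric])
  have 4: "\<alpha> * cnj \<alpha> + \<beta> * cnj \<beta> = 1"
    using assms(1) by (simp only: unit_spinor_iff)
  have 5: "\<alpha>' * cnj \<alpha>' + \<beta>' * cnj \<beta>' = 1" by (simp only: 3 4)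
  \<comment> \<open>Only the Hermitian product can be the phase: a unit vector multiplied by
    \<omega> has product \<omega> with the original one.\<close>
  let ?c = "\<alpha>' * cnj \<alpha> + \<beta>' * cnj \<beta>"
  show thesis
  proof
    have "?c * \<alpha> = \<alpha>' * (\<alpha> * cnj \<alpha>) + \<beta>' * (cnj \<beta> * \<alpha>)" by (simp add: algebra_simps)
    also have "\<dots> = \<alpha>' * (\<alpha>' * cnj \<alpha>' + \<beta>' * cnj \<beta>')"
      unfolding 2[symmetric] 3[symmetric] by (simp add: algebra_simps)
    finally show a: "\<alpha>' = ?c * \<alpha>" by (simp only: 5 mult_1_right)
    have "?c * \<beta> = \<alpha>' * (\<beta> * cnj \<alpha>) + \<beta>' * (\<beta> * cnj \<beta>)" by (simp add: algebra_simps)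
    also have "\<dots> = \<beta>' * (\<alpha>' * cnj \<alpha>' + \<beta>' * cnj \<beta>')"
      unfolding 1[symmetric] 3[symmetric] by (simp add: algebra_simps)
    finally show b: "\<beta>' = ?c * \<beta>" by (simp only: 5 mult_1_right)
    have "k * cnj k * (\<alpha> * cnj \<alpha> + \<beta> * cnj \<beta>) = (k * \<alpha>) * cnj (k * \<alpha>) + (k * \<beta>) * cnj (k * \<beta>)" for k
      by (simp add: algebra_simps)
    note k = this[of ?c]
    have "?c * cnj ?c = ?c * cnj ?c * (\<alpha> * cnj \<alpha> + \<beta> * cnj \<beta>)" by (simp only: 4 mult_1_right)
    also have "\<dots> = (?c * \<alpha>) * cnj (?c * \<alpha>) + (?c * \<beta>) * cnj (?c * \<beta>)"
      by (rule k)
    also have "\<dots> = 1" unfolding a[symmetric] b[symmetric] by (rule 5)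
    finally show "?c * cnj ?c = 1" .
  qed
qed

lemma norm_eq_1_cnj:
  assumes "z * cnj z = 1"
  shows "cmod z = 1"
proof -
  have "(cmod z)\<^sup>2 = 1"
    using assms by (simp only: complex_norm_square[symmetric] of_real_eq_1_iff)
  then show ?thesis by (simp add: abs_square_eq_1)
qed

lemma hopf_phase:
  assumes "\<omega> * cnj \<omega> = 1"
  shows "hopf (\<omega> * \<alpha>) (\<omega> * \<beta>) = hopf \<alpha> \<beta>"
proof -
  have "- 2 * (\<omega> * \<beta>) * cnj (\<omega> * \<alpha>) = (\<omega> * cnj \<omega>) * (- 2 * \<beta> * cnj \<alpha>)" by simp
  then have "- 2 * (\<omega> * \<beta>) * cnj (\<omega> * \<alpha>) = - 2 * \<beta> * cnj \<alpha>" by (simp only: assms mult_1_left)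
  then show ?thesis
    using norm_eq_1_cnj[OF assms] unfolding hopf_def by (simp only: norm_mult mult_1_left)
qed

text \<open>For \<open>c = cos (t/2)\<close> and \<open>s = sin (t/2)\<close> the right-hand side is
  the point at angle \<open>t\<close> on a great circle: real combinations of \<open>F\<close> and
  \<open>J F\<close> carry half the angle of their direction.\<close>

lemma hopf_combination:
  fixes c s :: real and A B :: complex
  shows "hopf (c * A - s * cnj B) (c * B + s * cnj A) =
    (c\<^sup>2 - s\<^sup>2) *\<^sub>R hopf A B + (2 * c * s) *\<^sub>R conormal A B"
  by (simp add: hopf_def conormal_def vec_eq_iff forall_3 cmod_power2)
    (simp add: power2_eq_square algebra_simps)

lemma unit_spinor_combination:
  fixes c s :: real and A B :: complex
  assumes "unit_spinor A B" "c\<^sup>2 + s\<^sup>2 = 1"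
  shows "unit_spinor (c * A - s * cnj B) (c * B + s * cnj A)"
proof -
  have "(cmod (c * A - s * cnj B))\<^sup>2 + (cmod (c * B + s * cnj A))\<^sup>2
      = (c\<^sup>2 + s\<^sup>2) * ((cmod A)\<^sup>2 + (cmod B)\<^sup>2)"
    by (simp add: cmod_power2) (simp add: power2_eq_square algebra_simps)
  then show ?thesis using assms by (simp add: unit_spinor_def)
qed

lemma hopf_conormal_orthonormal:
  assumes "unit_spinor A B"
  shows "hopf A B \<bullet> hopf A B = 1" "conormal A B \<bullet> conormal A B = 1" "hopf A B \<bullet> conormal A B = 0"
proof -
  let ?n = "(Re A)\<^sup>2 + (Im A)\<^sup>2 + ((Re B)\<^sup>2 + (Im B)\<^sup>2)"
  have 1: "?n = 1" using assms by (simp add: unit_spinor_def cmod_power2)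
  have "hopf A B \<bullet> hopf A B = ?n\<^sup>2"
    unfolding hopf_def inner_vec_def sum_3 cmod_power2
    by (simp add: power2_eq_square algebra_simps)
  then show "hopf A B \<bullet> hopf A B = 1" using 1 by simp
  have "conormal A B \<bullet> conormal A B = ?n\<^sup>2"
    unfolding conormal_def inner_vec_def sum_3
    by (simp add: power2_eq_square algebra_simps)
  then show "conormal A B \<bullet> conormal A B = 1" using 1 by simp
  show "hopf A B \<bullet> conormal A B = 0"
    unfolding hopf_def conormal_def inner_vec_def sum_3 cmod_power2
    by (simp add: power2_eq_square algebra_simps)
qed

section \<open>Half angles and frames adapted to two directions\<close>

lemma half_angle:
  fixes X Y :: real
  assumes "X\<^sup>2 + Y\<^sup>2 = 1"
  obtains c s where "c\<^sup>2 + s\<^sup>2 = 1" "c\<^sup>2 - s\<^sup>2 = X" "2 * c * s = Y"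
proof -
  obtain t where t: "X = cos t" "Y = sin t" using assms sincos_total_2pi by metis
  show thesis
  proof
    show "(cos (t/2))\<^sup>2 + (sin (t/2))\<^sup>2 = 1" by simp
    show "(cos (t/2))\<^sup>2 - (sin (t/2))\<^sup>2 = X" using cos_double[of "t/2"] t by simp
    show "2 * cos (t/2) * sin (t/2) = Y" using sin_double[of "t/2"] t by simp
  qed
qed

text \<open>In the basis \<open>U\<close>, \<open>J U\<close> the spinor \<open>V\<close> has
  complex coefficients. Replacing \<open>U\<close> by \<open>\<mu> U\<close> multiplies
  \<open>J U\<close> by \<open>cnj \<mu>\<close>, and \<open>V\<close> may be divided by a phase
  \<open>\<omega>\<close>; these two free phases make both coefficients nonnegative reals.
  Geometrically, the frame is turned about the direction of \<open>U\<close> until its plane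
  contains the direction of \<open>V\<close>.\<close>

lemma spinor_frame:
  assumes U: "unit_spinor U1 U2" and V: "unit_spinor V1 V2"
  obtains A B c s where "unit_spinor A B" "hopf A B = hopf U1 U2"
    "c\<^sup>2 + s\<^sup>2 = (1::real)" "hopf (c * A - s * cnj B) (c * B + s * cnj A) = hopf V1 V2"
proof -
  have U': "U1 * cnj U1 + U2 * cnj U2 = 1"
    using U by (simp only: unit_spinor_iff)
  \<comment> \<open>Hermitian products of \<open>V\<close> with the orthonormal pair
    \<open>U\<close>, \<open>J U\<close>.\<close>
  define \<xi> where "\<xi> = V1 * cnj U1 + V2 * cnj U2"
  define \<eta> where "\<eta> = V2 * U1 - V1 * U2"
  have V12: "V1 = \<xi> * U1 - \<eta> * cnj U2" "V2 = \<xi> * U2 + \<eta> * cnj U1"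
  proof -
    have "\<xi> * U1 - \<eta> * cnj U2 = V1 * (U1 * cnj U1 + U2 * cnj U2)"
      "\<xi> * U2 + \<eta> * cnj U1 = V2 * (U1 * cnj U1 + U2 * cnj U2)"
      unfolding \<xi>_def \<eta>_def by (simp_all add: algebra_simps)
    then show "V1 = \<xi> * U1 - \<eta> * cnj U2" "V2 = \<xi> * U2 + \<eta> * cnj U1" using U' by simp_all
  qed
  have pol: "\<exists>\<rho>::complex. z = cmod z * \<rho> \<and> \<rho> * cnj \<rho> = 1" for z :: complex
  proof (cases "z = 0")
    case False
    then have "sgn z * cnj (sgn z) = 1"
      by (simp only: complex_norm_square[symmetric] norm_sgn) simp
    moreover have "z = cmod z * sgn z" using False by (simp add: sgn_eq)
    ultimately show ?thesis by blast
  qed (auto intro: exI[of _ 1])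
  obtain \<rho>\<^sub>1 :: complex where r1: "\<xi> = cmod \<xi> * \<rho>\<^sub>1" "\<rho>\<^sub>1 * cnj \<rho>\<^sub>1 = 1" using pol by blast
  obtain \<rho>\<^sub>2 :: complex where r2: "\<eta> = cmod \<eta> * \<rho>\<^sub>2" "\<rho>\<^sub>2 * cnj \<rho>\<^sub>2 = 1" using pol by blast
  \<comment> \<open>The coefficients become moduli when \<open>\<omega> \<mu>\<close> and
    \<open>\<omega> cnj \<mu>\<close> are their phases. Multiplying the two conditions gives
    \<open>\<omega>^2 = \<rho>\<^sub>1 \<rho>\<^sub>2\<close>, and the first one then determines
    \<open>\<mu>\<close>.\<close>
  define \<omega> where "\<omega> = csqrt (\<rho>\<^sub>1 * \<rho>\<^sub>2)"
  have omega2: "\<omega> * \<omega> = \<rho>\<^sub>1 * \<rho>\<^sub>2" by (simp add: \<omega>_def flip: power2_eq_square)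
  have n1: "cmod \<rho>\<^sub>1 = 1" "cmod \<rho>\<^sub>2 = 1"
    using r1(2) r2(2) by (simp_all add: norm_eq_1_cnj)
  have "cmod \<omega> = 1" unfolding \<omega>_def by (simp add: norm_mult n1 norm_csqrt)
  then have omega: "\<omega> * cnj \<omega> = 1" by (simp add: complex_norm_square[symmetric])
  define \<mu> where "\<mu> = \<rho>\<^sub>1 * cnj \<omega>"
  have mu: "\<mu> * cnj \<mu> = 1"
  proof -
    have "\<mu> * cnj \<mu> = (\<rho>\<^sub>1 * cnj \<rho>\<^sub>1) * (\<omega> * cnj \<omega>)" by (simp add: \<mu>_def)
    then show ?thesis using omega r1(2) by simp
  qed
  have m1: "\<omega> * \<mu> = \<rho>\<^sub>1"
  proof -
    have "\<omega> * \<mu> = \<rho>\<^sub>1 * (\<omega> * cnj \<omega>)" by (simp add: \<mu>_def)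
    then show ?thesis using omega by simp
  qed
  have m2: "\<omega> * cnj \<mu> = \<rho>\<^sub>2"
  proof -
    have "\<omega> * cnj \<mu> = cnj \<rho>\<^sub>1 * (\<omega> * \<omega>)" by (simp add: \<mu>_def)
    also have "\<dots> = (\<rho>\<^sub>1 * cnj \<rho>\<^sub>1) * \<rho>\<^sub>2" by (simp add: omega2)
    finally show ?thesis using r1(2) by simp
  qed
  define c s where "c = cmod \<xi>" and "s = cmod \<eta>"
  let ?A = "\<mu> * U1" and ?B = "\<mu> * U2"
  have "\<omega> * (c * ?A - s * cnj ?B) = c * (\<omega> * \<mu>) * U1 - s * (\<omega> * cnj \<mu>) * cnj U2"
    by (simp add: algebra_simps)
  also have "\<dots> = V1" using V12(1) r1(1) r2(1) by (simp add: m1 m2 c_def s_def)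
  finally have "V1 = \<omega> * (c * ?A - s * cnj ?B)" by simp
  moreover have "\<omega> * (c * ?B + s * cnj ?A) = c * (\<omega> * \<mu>) * U2 + s * (\<omega> * cnj \<mu>) * cnj U1"
    by (simp add: algebra_simps)
  then have "\<omega> * (c * ?B + s * cnj ?A) = V2"
    using V12(2) r1(1) r2(1) by (simp add: m1 m2 c_def s_def)
  ultimately have "hopf (c * ?A - s * cnj ?B) (c * ?B + s * cnj ?A) = hopf V1 V2"
    using hopf_phase[OF omega] by metis
  moreover have "unit_spinor ?A ?B"
    using U mu unfolding unit_spinor_def by (simp add: norm_mult norm_eq_1_cnj)
  moreover have "c\<^sup>2 + s\<^sup>2 = 1"
  proof -
    \<comment> \<open>Lagrange's identity: the left-hand side is the product of the squared norms of
      \<open>U\<close> and \<open>V\<close>.\<close>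
    have "\<xi> * cnj \<xi> + \<eta> * cnj \<eta> = (U1 * cnj U1 + U2 * cnj U2) * (V1 * cnj V1 + V2 * cnj V2)"
      unfolding \<xi>_def \<eta>_def by (simp add: algebra_simps)
    moreover have "V1 * cnj V1 + V2 * cnj V2 = 1"
      using V by (simp only: unit_spinor_iff)
    moreover have "complex_of_real (c\<^sup>2 + s\<^sup>2) = \<xi> * cnj \<xi> + \<eta> * cnj \<eta>"
      by (simp only: of_real_add complex_norm_square c_def s_def)
    ultimately have "complex_of_real (c\<^sup>2 + s\<^sup>2) = 1" by (simp only: U' mult_1)
    then show ?thesis by (simp only: of_real_eq_1_iff)
  qed
  moreover have "hopf ?A ?B = hopf U1 U2" by (rule hopf_phase[OF mu])
  ultimately show thesis using that by blast
qed

section \<open>From half angles to side lengths\<close>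

lemma parallelogram_det_value:
  fixes c s c' s' c'' s'' a b e f :: real
  defines "C \<equiv> c\<^sup>2 - s\<^sup>2"
  assumes unit: "c\<^sup>2 + s\<^sup>2 = 1" "c'\<^sup>2 + s'\<^sup>2 = 1" "c''\<^sup>2 + s''\<^sup>2 = 1"
    and f: "f * (c'\<^sup>2 - s'\<^sup>2) = a + b * C" "f * (2 * c' * s') = b * (2 * c * s)"
    and e: "e * (c''\<^sup>2 - s''\<^sup>2) = b * C - a" "e * (2 * c'' * s'') = b * (2 * c * s)"
  shows "4 * e * f * (((s * s') * (s * s'') - (c * c') * (c * c''))\<^sup>2
          + ((c * s' + s * c') * (s * s'') + (c * c') * (c * s'' + s * c''))\<^sup>2)
       = 2 * e * f + (a + b) * (e + f) + (a + b) * C * (e - f) + 2 * a * b * (1 - C\<^sup>2)"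
    (is "4 * e * f * ?K = _")
proof -
  \<comment> \<open>With angles measured from side 12, the pairs \<open>C, S\<close>,
    \<open>P, p\<close> and \<open>Q, q\<close> are cosine and sine for side 23 and the diagonals 13
    and 24; \<open>c, s\<close> and their primed versions belong to half of these angles.\<close>
  define S P Q p q where "S = 2 * c * s" and "P = c'\<^sup>2 - s'\<^sup>2" and "Q = c''\<^sup>2 - s''\<^sup>2"
    and "p = 2 * c' * s'" and "q = 2 * c'' * s''"
  have half: "2 * c\<^sup>2 = 1 + C" "2 * s\<^sup>2 = 1 - C" "2 * c'\<^sup>2 = 1 + P" "2 * s'\<^sup>2 = 1 - P"
    "2 * c''\<^sup>2 = 1 + Q" "2 * s''\<^sup>2 = 1 - Q"
    using unit unfolding C_def P_def Q_def by linarith+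
  have S2: "S\<^sup>2 = 1 - C\<^sup>2"
  proof -
    have "S\<^sup>2 = (2 * c\<^sup>2) * (2 * s\<^sup>2)" by (simp add: S_def power2_eq_square)
    then show ?thesis unfolding half by (simp add: power2_eq_square algebra_simps)
  qed
  have g: "(c * s' + s * c') * (s * s'') + (c * c') * (c * s'' + s * c'')
      = (c\<^sup>2 + s\<^sup>2) * (c' * s'') + c * s * (s' * s'' + c' * c'')"
    by (simp add: power2_eq_square algebra_simps)
  note g = g[unfolded unit(1) mult_1]
  \<comment> \<open>The mixed terms \<open>2 c^2 s^2 c' s' c'' s''\<close> of the two squares
    cancel. What remains are squares and products \<open>c s\<close>, \<open>c' s'\<close>,
    \<open>c'' s''\<close>, all expressible by full angles.\<close>
  have "?K = s\<^sup>2 * s'\<^sup>2 * s''\<^sup>2 * (c\<^sup>2 + s\<^sup>2) + c\<^sup>2 * c'\<^sup>2 * c''\<^sup>2 * (c\<^sup>2 + s\<^sup>2) + c'\<^sup>2 * s''\<^sup>2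
      + (2 * c * s) * (c' * s') * s''\<^sup>2 + (2 * c * s) * (c'' * s'') * c'\<^sup>2"
    unfolding g by (simp add: power2_eq_square algebra_simps)
  then have "8 * ?K = (2 * s\<^sup>2) * (2 * s'\<^sup>2) * (2 * s''\<^sup>2) + (2 * c\<^sup>2) * (2 * c'\<^sup>2) * (2 * c''\<^sup>2)
      + 2 * (2 * c'\<^sup>2) * (2 * s''\<^sup>2) + 2 * S * p * (2 * s''\<^sup>2) + 2 * S * q * (2 * c'\<^sup>2)"
    unfolding unit(1) by (simp add: S_def p_def q_def)
  also have "\<dots> = (1 - C) * (1 - P) * (1 - Q) + (1 + C) * (1 + P) * (1 + Q)
      + 2 * (1 + P) * (1 - Q) + 2 * S * p * (1 - Q) + 2 * S * q * (1 + P)"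
    unfolding half ..
  finally have "8 * e * f * ?K = e * f * \<dots>" by (simp only: ac_simps)
  \<comment> \<open>Every \<open>P\<close> or \<open>p\<close> is paired with a factor
    \<open>f\<close>, every \<open>Q\<close> or \<open>q\<close> with \<open>e\<close>. These
    products are the components of the diagonals, so only the angle between the sides
    survives.\<close>
  also have "\<dots> = 2 * e * f + 2 * (f * P) * (e * Q) + 2 * C * (e * (f * P) + f * (e * Q))
      + 2 * (f + f * P) * (e - e * Q) + 2 * S * (f * p) * (e - e * Q) + 2 * S * (e * q) * (f + f * P)"
    by (simp add: algebra_simps)
  also have "\<dots> = 2 * e * f + 2 * (a + b * C) * (b * C - a) + 2 * C * (e * (a + b * C) + f * (b * C - a))
      + 2 * (f + a + b * C) * (e + a - b * C) + 2 * b * S\<^sup>2 * (e + f + 2 * a)"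
    unfolding f[folded P_def p_def S_def] e[folded Q_def q_def S_def]
    by (simp add: power2_eq_square algebra_simps)
  also have "\<dots> = 2 * (2 * e * f + (a + b) * (e + f) + (a + b) * C * (e - f) + 2 * a * b * (1 - C\<^sup>2))"
    unfolding S2 by (simp add: power2_eq_square algebra_simps)
  finally show ?thesis by simp
qed

text \<open>Since \<open>4 a b C = f^2 - e^2\<close>, the last angle can be eliminated too; modulo
  the parallelogram law the difference from the product of distances then factors.\<close>

lemma parallelogram_D4_value:
  fixes a b e f C K :: real
  assumes sq: "f\<^sup>2 = a\<^sup>2 + b\<^sup>2 + 2 * a * b * C" "e\<^sup>2 = a\<^sup>2 + b\<^sup>2 - 2 * a * b * C"
    and K: "4 * e * f * K
      = 2 * e * f + (a + b) * (e + f) + (a + b) * C * (e - f) + 2 * a * b * (1 - C\<^sup>2)"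
  shows "64 * (a * f * b * b * e * a) * K = 64 * (a * f * b * b * e * a)
    + 8 * a * b * ((a + b - e) * (a + b - f))
      * (2 * (a + b)\<^sup>2 + 2 * (a + b) * (e + f) + e * f + (a - b)\<^sup>2)"
proof -
  have 1: "4 * a * b * C = f\<^sup>2 - e\<^sup>2" and 2: "e\<^sup>2 + f\<^sup>2 = 2 * (a\<^sup>2 + b\<^sup>2)" using sq by simp_all
  have "64 * (a * f * b * b * e * a) * K = 16 * a\<^sup>2 * b\<^sup>2 * (4 * e * f * K)"
    by (simp add: power2_eq_square)
  also have "\<dots> = 32 * a\<^sup>2 * b\<^sup>2 * e * f + 16 * a\<^sup>2 * b\<^sup>2 * (a + b) * (e + f)
      + 4 * a * b * (a + b) * (4 * a * b * C) * (e - f) + 32 * a^3 * b^3 - 2 * a * b * (4 * a * b * C)\<^sup>2"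
    unfolding K by (simp add: power2_eq_square power3_eq_cube algebra_simps)
  also have "\<dots> = 64 * (a * f * b * b * e * a)
    + 8 * a * b * ((a + b - e) * (a + b - f))
      * (2 * (a + b)\<^sup>2 + 2 * (a + b) * (e + f) + e * f + (a - b)\<^sup>2)"
    unfolding 1 using 2 by algebra
  finally show ?thesis .
qed

section \<open>The Atiyah matrix in a frame\<close>

text \<open>The real combination \<open>c F + s J F\<close>, where \<open>F = A t + B\<close>.\<close>

definition frame_form :: "complex \<Rightarrow> complex \<Rightarrow> real \<Rightarrow> real \<Rightarrow> complex poly" where
  "frame_form A B c s =
    [:of_real c * B + of_real s * cnj A, of_real c * A - of_real s * cnj B:]"

text \<open>Expansion in the cubic basis \<open>(J F)^3\<close>, \<open>F (J F)^2\<close>,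
  \<open>F^2 (J F)\<close>, \<open>F^3\<close>, where \<open>J F = [:cnj A, - cnj B:]\<close>. Apart
  from the common factor \<open>j * k * l\<close> all coordinates are real.\<close>

lemma frame_form_prod:
  "smult j (frame_form A B c s) * smult k (frame_form A B c' s') * smult l (frame_form A B c'' s'')
   = smult (j * k * l)
      (smult (of_real (s * s' * s'')) ([:cnj A, - cnj B:]^3)
     + smult (of_real (c * s' * s'' + s * c' * s'' + s * s' * c'')) ([:B, A:] * [:cnj A, - cnj B:]^2)
     + smult (of_real (c * c' * s'' + c * s' * c'' + s * c' * c'')) ([:B, A:]^2 * [:cnj A, - cnj B:])
     + smult (of_real (c * c' * c'')) ([:B, A:]^3))"
proof -
  have F: "frame_form A B c s = smult (of_real c) [:B, A:] + smult (of_real s) [:cnj A, - cnj B:]" for c s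
    by (simp add: frame_form_def algebra_simps)
  have *: "(smult a x + smult b y) * (smult a' x + smult b' y) * (smult a'' x + smult b'' y)
    = smult (b * b' * b'') (y^3)
     + smult (a * b' * b'' + b * a' * b'' + b * b' * a'') (x * y^2)
     + smult (a * a' * b'' + a * b' * a'' + b * a' * a'') (x^2 * y)
     + smult (a * a' * a'') (x^3)" for a a' a'' b b' b'' :: complex and x y :: "complex poly"
    by (simp add: algebra_simps power2_eq_square power3_eq_cube smult_add_left smult_add_right)
  show ?thesis
    unfolding F mult_smult_left mult_smult_right * smult_smult by (simp add: mult.commute mult.left_commute)
qed

text \<open>Reversing a pair applies \<open>J\<close>, which is antilinear with
  \<open>J (J F) = - F\<close>; hence the conjugated phase and the coefficients
  \<open>(- s, c)\<close>.\<close>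

lemma atiyah_lin_frame:
  assumes "\<alpha> i j = \<omega> * (of_real c * A - of_real s * cnj B)"
    and "\<beta> i j = \<omega> * (of_real c * B + of_real s * cnj A)"
    and "i < j"
  shows "atiyah_lin \<alpha> \<beta> i j = smult \<omega> (frame_form A B c s)"
    and "atiyah_lin \<alpha> \<beta> j i = smult (cnj \<omega>) (frame_form A B (- s) c)"
  using assms(3) less_not_sym[OF assms(3)] by (simp_all add: atiyah_lin_def frame_form_def assms) (simp_all add: algebra_simps)

text \<open>The third symmetric power of the change of basis from \<open>1, t\<close> to \<open>J F, F\<close>.\<close>

definition cubic_matrix :: "complex \<Rightarrow> complex \<Rightarrow> complex^4^4" where
  "cubic_matrix A B =
    vector (map (\<lambda>p. vector (map (\<lambda>j. coeff p (j - 1)) [1, 2, 3, 4]))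
      [[:cnj A, - cnj B:]^3, [:B, A:] * [:cnj A, - cnj B:]^2, [:B, A:]^2 * [:cnj A, - cnj B:], [:B, A:]^3])"

text \<open>The base change on linear forms has determinant \<open>A cnj A + B cnj B\<close>. The
  exponent \<open>6 = 0 + 1 + 2 + 3\<close> counts the occurrences of either basis form in the four
  cubic monomials. For a unit spinor the value is 1.\<close>

lemma det_cubic_matrix: "det (cubic_matrix A B) = (A * cnj A + B * cnj B)^6"
  unfolding det_4 cubic_matrix_def
  by (simp add: power2_eq_square power3_eq_cube coeff_mult numeral_eq_Suc algebra_simps)

lemma atiyah_poly_eq:
  "atiyah_poly \<alpha> \<beta> 1 = atiyah_lin \<alpha> \<beta> 1 2 * atiyah_lin \<alpha> \<beta> 1 3 * atiyah_lin \<alpha> \<beta> 1 4"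
  "atiyah_poly \<alpha> \<beta> 2 = atiyah_lin \<alpha> \<beta> 2 1 * atiyah_lin \<alpha> \<beta> 2 3 * atiyah_lin \<alpha> \<beta> 2 4"
  "atiyah_poly \<alpha> \<beta> 3 = atiyah_lin \<alpha> \<beta> 3 1 * atiyah_lin \<alpha> \<beta> 3 2 * atiyah_lin \<alpha> \<beta> 3 4"
  "atiyah_poly \<alpha> \<beta> 4 = atiyah_lin \<alpha> \<beta> 4 1 * atiyah_lin \<alpha> \<beta> 4 2 * atiyah_lin \<alpha> \<beta> 4 3"
proof -
  have "{1..4} - {1} = {2, 3, 4::nat}" "{1..4} - {2} = {1, 3, 4::nat}"
    "{1..4} - {3} = {1, 2, 4::nat}" "{1..4} - {4} = {1, 2, 3::nat}"
    by auto
  then show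
    "atiyah_poly \<alpha> \<beta> 1 = atiyah_lin \<alpha> \<beta> 1 2 * atiyah_lin \<alpha> \<beta> 1 3 * atiyah_lin \<alpha> \<beta> 1 4"
    "atiyah_poly \<alpha> \<beta> 2 = atiyah_lin \<alpha> \<beta> 2 1 * atiyah_lin \<alpha> \<beta> 2 3 * atiyah_lin \<alpha> \<beta> 2 4"
    "atiyah_poly \<alpha> \<beta> 3 = atiyah_lin \<alpha> \<beta> 3 1 * atiyah_lin \<alpha> \<beta> 3 2 * atiyah_lin \<alpha> \<beta> 3 4"
    "atiyah_poly \<alpha> \<beta> 4 = atiyah_lin \<alpha> \<beta> 4 1 * atiyah_lin \<alpha> \<beta> 4 2 * atiyah_lin \<alpha> \<beta> 4 3"
    by (simp_all add: atiyah_poly_def mult.assoc)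
qed

text \<open>The coefficient pattern is that of a parallelogram: side 12 is \<open>F\<close> itself,
  34 is opposite to it, and the parallel sides 14 and 23 share \<open>(c, s)\<close>; only the
  diagonals bring further pairs.\<close>

lemma det_atiyah_matrix_frame:
  fixes c s c' s' c'' s'' :: real
  assumes "unit_spinor A B"
    and l: "atiyah_lin \<alpha> \<beta> 1 2 = smult \<omega>\<^sub>1 (frame_form A B 1 0)"
      "atiyah_lin \<alpha> \<beta> 2 1 = smult (cnj \<omega>\<^sub>1) (frame_form A B 0 1)"
      "atiyah_lin \<alpha> \<beta> 1 3 = smult \<omega>\<^sub>2 (frame_form A B c' s')"
      "atiyah_lin \<alpha> \<beta> 3 1 = smult (cnj \<omega>\<^sub>2) (frame_form A B (- s') c')"
      "atiyah_lin \<alpha> \<beta> 1 4 = smult \<omega>\<^sub>3 (frame_form A B c s)"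
      "atiyah_lin \<alpha> \<beta> 4 1 = smult (cnj \<omega>\<^sub>3) (frame_form A B (- s) c)"
      "atiyah_lin \<alpha> \<beta> 2 3 = smult \<omega>\<^sub>4 (frame_form A B c s)"
      "atiyah_lin \<alpha> \<beta> 3 2 = smult (cnj \<omega>\<^sub>4) (frame_form A B (- s) c)"
      "atiyah_lin \<alpha> \<beta> 2 4 = smult \<omega>\<^sub>5 (frame_form A B c'' s'')"
      "atiyah_lin \<alpha> \<beta> 4 2 = smult (cnj \<omega>\<^sub>5) (frame_form A B (- s'') c'')"
      "atiyah_lin \<alpha> \<beta> 3 4 = smult \<omega>\<^sub>6 (frame_form A B 0 1)"
      "atiyah_lin \<alpha> \<beta> 4 3 = smult (cnj \<omega>\<^sub>6) (frame_form A B (- 1) 0)"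
    and \<omega>: "\<omega>\<^sub>1 * cnj \<omega>\<^sub>1 = 1" "\<omega>\<^sub>2 * cnj \<omega>\<^sub>2 = 1" "\<omega>\<^sub>3 * cnj \<omega>\<^sub>3 = 1"
      "\<omega>\<^sub>4 * cnj \<omega>\<^sub>4 = 1" "\<omega>\<^sub>5 * cnj \<omega>\<^sub>5 = 1" "\<omega>\<^sub>6 * cnj \<omega>\<^sub>6 = 1"
  shows "det (atiyah_matrix \<alpha> \<beta>) = of_real
    (((s * s') * (s * s'') - (c * c') * (c * c''))\<^sup>2
      + ((c * s' + s * c') * (s * s'') + (c * c') * (c * s'' + s * c''))\<^sup>2)"
proof -
  \<comment> \<open>Each phase enters once for a pair and once conjugated for the reversed pair, so
    the four row phases multiply to 1.\<close>
  define k1 k2 k3 k4 where "k1 = \<omega>\<^sub>1 * \<omega>\<^sub>2 * \<omega>\<^sub>3" and "k2 = cnj \<omega>\<^sub>1 * \<omega>\<^sub>4 * \<omega>\<^sub>5"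
    and "k3 = cnj \<omega>\<^sub>2 * cnj \<omega>\<^sub>4 * \<omega>\<^sub>6" and "k4 = cnj \<omega>\<^sub>3 * cnj \<omega>\<^sub>5 * cnj \<omega>\<^sub>6"
  have "k1 * k2 * k3 * k4 = (\<omega>\<^sub>1 * cnj \<omega>\<^sub>1) * (\<omega>\<^sub>2 * cnj \<omega>\<^sub>2) * (\<omega>\<^sub>3 * cnj \<omega>\<^sub>3)
      * (\<omega>\<^sub>4 * cnj \<omega>\<^sub>4) * (\<omega>\<^sub>5 * cnj \<omega>\<^sub>5) * (\<omega>\<^sub>6 * cnj \<omega>\<^sub>6)"
    by (simp add: k1_def k2_def k3_def k4_def ac_simps)
  then have k: "k1 * k2 * k3 * k4 = 1" by (simp only: \<omega> mult_1)
  \<comment> \<open>Coordinates, along \<open>(J F)^2\<close>, \<open>F (J F)\<close>,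
    \<open>F^2\<close>, of the product of the forms 13 and 14, and of the forms 23 and 24. Up to
    phase, row 1 is \<open>F\<close> times the first and row 2 is \<open>J F\<close> times the
    second. Applying \<open>J\<close> swaps the outer coordinates and negates the middle one; row 3
    is \<open>J F\<close> times the first image, row 4 is \<open>- F\<close> times the
    second.\<close>
  define X Y Z X' Y' Z' where "X = s * s'" and "Y = c * s' + s * c'" and "Z = c * c'"
    and "X' = s * s''" and "Y' = c * s'' + s * c''" and "Z' = c * c''"
  note XYZ = X_def Y_def Z_def X'_def Y'_def Z'_def
  let ?G = "[:cnj A, - cnj B:]" and ?F = "[:B, A:]"
  have p1: "atiyah_poly \<alpha> \<beta> 1 = smult k1 (smult (of_real Y) (?F^2 * ?G) + smult (of_real X) (?F * ?G^2)
      + smult (of_real Z) (?F^3))"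
    unfolding atiyah_poly_eq l frame_form_prod
    by (simp add: XYZ k1_def mult.commute add.commute)
  have p2: "atiyah_poly \<alpha> \<beta> 2 = smult k2 (smult (of_real X') (?G^3) + smult (of_real Y') (?F * ?G^2)
      + smult (of_real Z') (?F^2 * ?G))"
    unfolding atiyah_poly_eq l frame_form_prod
    by (simp add: XYZ k2_def mult.commute add.commute)
  have p3: "atiyah_poly \<alpha> \<beta> 3 = smult k3 (smult (of_real Z) (?G^3) + smult (of_real (- Y)) (?F * ?G^2)
      + smult (of_real X) (?F^2 * ?G))"
    unfolding atiyah_poly_eq l frame_form_prod
    by (simp add: XYZ k3_def mult.commute add.commute)
  have p4: "atiyah_poly \<alpha> \<beta> 4 = smult k4 (smult (of_real (- Z')) (?F * ?G^2) + smult (of_real Y') (?F^2 * ?G)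
      + smult (of_real (- X')) (?F^3))"
    unfolding atiyah_poly_eq l frame_form_prod
    by (simp add: XYZ k4_def mult.commute add.commute)
  \<comment> \<open>Multiples of \<open>F\<close> have no \<open>(J F)^3\<close> term and multiples
    of \<open>J F\<close> no \<open>F^3\<close> term, which gives the zeros in the outer
    columns.\<close>
  define N :: "complex^4^4" where "N = vector [
    vector [0, k1 * X, k1 * Y, k1 * Z],
    vector [k2 * X', k2 * Y', k2 * Z', 0],
    vector [k3 * Z, - (k3 * Y), k3 * X, 0],
    vector [0, - (k4 * Z'), k4 * Y', - (k4 * X')]]"
  have "atiyah_matrix \<alpha> \<beta> = N ** cubic_matrix A B"
    unfolding atiyah_matrix_def cubic_matrix_def N_def vec_eq_iff forall_4 matrix_matrix_mult_def
    by (simp add: sum_4 p1[unfolded One_nat_def] p2 p3 p4 distrib_left right_diff_distrib mult.assoc del: mult_pCons_left mult_pCons_right)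
  then have "det (atiyah_matrix \<alpha> \<beta>) = det N * det (cubic_matrix A B)" by (simp add: det_mul)
  also have "det (cubic_matrix A B) = 1"
    using assms(1) unfolding det_cubic_matrix unit_spinor_iff by simp
  also have "det N = (k1 * k2 * k3 * k4) * of_real ((X * X' - Z * Z')\<^sup>2 + (Y * X' + Z * Y')\<^sup>2)"
    unfolding det_4 N_def by (simp add: power2_eq_square algebra_simps)
  finally show ?thesis unfolding k XYZ by simp
qed

section \<open>Spinors whose direction lies in the plane of a frame\<close>

lemma phase_in_frame:
  fixes c s :: real
  assumes "unit_spinor A B" "unit_spinor \<alpha> \<beta>" "c\<^sup>2 + s\<^sup>2 = 1"
    and "hopf \<alpha> \<beta> = (c\<^sup>2 - s\<^sup>2) *\<^sub>R hopf A B + (2 * c * s) *\<^sub>R conormal A B"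
  obtains \<omega> where "\<omega> * cnj \<omega> = 1"
    "\<alpha> = \<omega> * (of_real c * A - of_real s * cnj B)" "\<beta> = \<omega> * (of_real c * B + of_real s * cnj A)"
  using hopf_eq_imp_phase[OF unit_spinor_combination[OF assms(1,3)] assms(2)]
  unfolding hopf_combination assms(4) by blast

text \<open>Serves the diagonals, of which only the coordinates \<open>X\<close>, \<open>Y\<close>
  are known: orthonormality puts them on the unit circle, and the sign ambiguity of the half-angle
  pair is absorbed by \<open>\<omega>\<close>. For sides the pair is prescribed, as in
  \<open>phase_in_frame\<close>, so that parallel sides share it.\<close>

lemma spinor_in_frame:
  fixes X Y :: real
  assumes "unit_spinor A B" "unit_spinor \<alpha> \<beta>"
    and "hopf \<alpha> \<beta> = X *\<^sub>R hopf A B + Y *\<^sub>R conormal A B"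
  obtains c s \<omega> where "c\<^sup>2 + s\<^sup>2 = (1::real)" "c\<^sup>2 - s\<^sup>2 = X" "2 * c * s = Y" "\<omega> * cnj \<omega> = 1"
    "\<alpha> = \<omega> * (of_real c * A - of_real s * cnj B)" "\<beta> = \<omega> * (of_real c * B + of_real s * cnj A)"
proof -
  have "hopf \<alpha> \<beta> \<bullet> hopf \<alpha> \<beta> = X\<^sup>2 + Y\<^sup>2"
    using hopf_conormal_orthonormal[OF assms(1)] unfolding assms(3)
    by (simp add: inner_simps inner_commute power2_eq_square)
  then have "X\<^sup>2 + Y\<^sup>2 = 1" using hopf_conormal_orthonormal[OF assms(2)] by simp
  then obtain c s where cs: "c\<^sup>2 + s\<^sup>2 = 1" "c\<^sup>2 - s\<^sup>2 = X" "2 * c * s = Y"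
    by (rule half_angle)
  obtain \<omega> where "\<omega> * cnj \<omega> = 1" "\<alpha> = \<omega> * (of_real c * A - of_real s * cnj B)"
      "\<beta> = \<omega> * (of_real c * B + of_real s * cnj A)"
    by (rule phase_in_frame[OF assms(1,2) cs(1)]) (simp add: cs(2,3) assms(3))
  then show thesis using that cs by blast
qed

section \<open>Directions between points and normalized linear forms\<close>

lemma norm_direction: "p \<noteq> q \<Longrightarrow> norm (direction p q) = 1"
  by (simp add: direction_def dist_norm norm_minus_commute)

lemma scaleR_direction: "dist p q *\<^sub>R direction p q = q - p"
  by (cases "p = q") (simp_all add: direction_def)

lemma atiyah_choice_hopf:
  assumes "atiyah_choice x \<alpha> \<beta>" "(i, j) \<in> pairs4" "x i \<noteq> x j"
  shows "unit_spinor (\<alpha> i j) (\<beta> i j)" "hopf (\<alpha> i j) (\<beta> i j) = direction (x i) (x j)"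
proof -
  have *: "(cmod (\<alpha> i j))\<^sup>2 + (cmod (\<beta> i j))\<^sup>2 = 1"
    "case stereo (direction (x i) (x j)) of None \<Rightarrow> \<alpha> i j = 0 | Some t \<Rightarrow> \<alpha> i j * t + \<beta> i j = 0"
    using assms(1,2) unfolding atiyah_choice_def by blast+
  show u: "unit_spinor (\<alpha> i j) (\<beta> i j)" using *(1) by (simp add: unit_spinor_def)
  show "hopf (\<alpha> i j) (\<beta> i j) = direction (x i) (x j)"
    by (rule hopf_stereo[OF norm_direction[OF assms(3)] u *(2)])
qed

section \<open>Enumeration of the index sets\<close>

lemma pairs4_eq: "pairs4 = {(1, 2), (1, 3), (1, 4), (2, 3), (2, 4), (3, 4)}"
proof -
  have "1 \<le> i \<and> i < j \<and> j \<le> 4 \<longleftrightarrow> i = 1 \<and> (j = 2 \<or> j = 3 \<or> j = 4) \<or> i = 2 \<and> (j = 3 \<or> j = 4) \<or> i = 3 \<and> j = 4"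
    for i j :: nat
    by presburger
  then show ?thesis by (simp add: set_eq_iff) blast
qed

lemma triples4_eq: "triples4 = {(1, 2, 3), (1, 2, 4), (1, 3, 4), (2, 3, 4)}"
proof -
  have "1 \<le> i \<and> i < j \<and> j < k \<and> k \<le> 4 \<longleftrightarrow>
      i = 1 \<and> (j = 2 \<and> (k = 3 \<or> k = 4) \<or> j = 3 \<and> k = 4) \<or> i = 2 \<and> j = 3 \<and> k = 4"
    for i j k :: nat
    by presburger
  then show ?thesis by (simp add: set_eq_iff) blast
qed

lemma opposite_triples4_eq:
  "{(l, i, j, k). l \<in> {1..4} \<and> i < j \<and> j < k \<and> {i, j, k} = {1..4} - {l}} =
    {(1, 2, 3, 4), (2, 1, 3, 4), (3, 1, 2, 4), (4, 1, 2, 3::nat)}" (is "?L = ?R")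
proof
  show "?L \<subseteq> ?R"
  proof
    fix t
    assume "t \<in> ?L"
    then obtain l i j k where t: "t = (l, i, j, k)"
      and h: "l \<in> {1..4}" "i < j" "j < k" "{i, j, k} = {1..4} - {l}"
      by blast
    have "i \<in> {1..4} - {l}" "j \<in> {1..4} - {l}" "k \<in> {1..4} - {l}" unfolding h(4)[symmetric] by simp_all
    then have "1 \<le> l \<and> l \<le> 4 \<and> 1 \<le> i \<and> k \<le> 4 \<and> l \<noteq> i \<and> l \<noteq> j \<and> l \<noteq> k" using h(1) by simp
    then have "l = 1 \<and> i = 2 \<and> j = 3 \<and> k = 4 \<or> l = 2 \<and> i = 1 \<and> j = 3 \<and> k = 4
        \<or> l = 3 \<and> i = 1 \<and> j = 2 \<and> k = 4 \<or> l = 4 \<and> i = 1 \<and> j = 2 \<and> k = 3"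
      using h(2,3) by presburger
    then show "t \<in> ?R" unfolding t by blast
  qed
  show "?R \<subseteq> ?L" by auto
qed

section \<open>Closed form of the determinant for a parallelogram\<close>

lemma D4_parallelogram:
  assumes distinct: "inj_on x {1..4}"
    and par: "parallelogram (x 1) (x 2) (x 3) (x 4)"
    and choice: "atiyah_choice x \<alpha> \<beta>"
  defines "a \<equiv> pdist x 1 2" and "b \<equiv> pdist x 2 3" and "e \<equiv> pdist x 2 4" and "f \<equiv> pdist x 1 3"
  shows "D4 x \<alpha> \<beta> = of_real (64 * (a * f * b * b * e * a)
    + 8 * a * b * ((a + b - e) * (a + b - f))
      * (2 * (a + b)\<^sup>2 + 2 * (a + b) * (e + f) + e * f + (a - b)\<^sup>2))"
proof -
  have ne: "x i \<noteq> x j" if "(i, j) \<in> pairs4" for i j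
    using that inj_onD[OF distinct, of i j] by auto
  note sp = atiyah_choice_hopf(1)[OF choice _ ne] and hp = atiyah_choice_hopf(2)[OF choice _ ne]
  have x34: "x 4 - x 3 = - (x 2 - x 1)" and x23: "x 3 - x 2 = x 4 - x 1"
    using par unfolding parallelogram_def by (simp_all add: algebra_simps)
  have pos: "a > 0" "b > 0" "e > 0" "f > 0"
    using ne unfolding a_def b_def e_def f_def by auto
  have d34: "pdist x 3 4 = a" and d14: "pdist x 1 4 = b"
    using x34 x23 unfolding a_def b_def by (metis dist_norm dist_commute norm_minus_cancel)+
  have mem: "(1, 2) \<in> pairs4" "(1, 3) \<in> pairs4" "(1, 4) \<in> pairs4" "(2, 3) \<in> pairs4"
    "(2, 4) \<in> pairs4" "(3, 4) \<in> pairs4"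
    by simp_all
  note sp = sp[OF mem(1) mem(1)] sp[OF mem(2) mem(2)] sp[OF mem(3) mem(3)]
      sp[OF mem(4) mem(4)] sp[OF mem(5) mem(5)] sp[OF mem(6) mem(6)]
  note hp = hp[OF mem(1) mem(1)] hp[OF mem(2) mem(2)] hp[OF mem(3) mem(3)]
      hp[OF mem(4) mem(4)] hp[OF mem(5) mem(5)] hp[OF mem(6) mem(6)]
  \<comment> \<open>All six directions lie in the span of sides 12 and 23, so a frame adapted to
    these two suffices.\<close>
  obtain A B c s where AB: "unit_spinor A B" "hopf A B = direction (x 1) (x 2)"
    and cs: "c\<^sup>2 + s\<^sup>2 = (1::real)"
    and v: "hopf (of_real c * A - of_real s * cnj B) (of_real c * B + of_real s * cnj A) = direction (x 2) (x 3)"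
    using spinor_frame[OF sp(1) sp(4)] unfolding hp by blast
  \<comment> \<open>As \<open>k\<close> comes from the spinor and not from a second side, it is a
    unit vector orthogonal to \<open>u\<close> even for collinear vertices, where
    \<open>S = 0\<close>.\<close>
  define u k where "u = hopf A B" and "k = conormal A B"
  define C S where "C = c\<^sup>2 - s\<^sup>2" and "S = 2 * c * s"
  have v: "direction (x 2) (x 3) = C *\<^sub>R u + S *\<^sub>R k"
    using v unfolding hopf_combination u_def k_def C_def S_def by simp
  have x12: "x 2 - x 1 = a *\<^sub>R u"
    using scaleR_direction[of "x 1" "x 2"] AB(2) unfolding u_def a_def by simp
  have x23': "x 3 - x 2 = b *\<^sub>R (C *\<^sub>R u + S *\<^sub>R k)"
    using scaleR_direction[of "x 2" "x 3"] unfolding v b_def by simp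
  have orth: "u \<bullet> u = 1" "k \<bullet> k = 1" "u \<bullet> k = 0" "k \<bullet> u = 0"
    using hopf_conormal_orthonormal[OF AB(1)] unfolding u_def k_def by (simp_all add: inner_commute)
  have CS: "C\<^sup>2 + S\<^sup>2 = 1"
  proof -
    have "C\<^sup>2 + S\<^sup>2 = (c\<^sup>2 + s\<^sup>2)\<^sup>2"
      unfolding C_def S_def by (simp add: power2_eq_square algebra_simps)
    then show ?thesis using cs by simp
  qed
  have x13: "x 3 - x 1 = (a + b * C) *\<^sub>R u + (b * S) *\<^sub>R k"
    using arg_cong2[OF x12 x23', of "(+)"] by (simp add: algebra_simps)
  have x24: "x 4 - x 2 = (b * C - a) *\<^sub>R u + (b * S) *\<^sub>R k"
    using arg_cong2[OF x23' x12, of "(-)"] x23 by (simp add: algebra_simps)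
  have nrm: "((m *\<^sub>R u + n *\<^sub>R k) \<bullet> (m *\<^sub>R u + n *\<^sub>R k)) = m\<^sup>2 + n\<^sup>2" for m n
    by (simp add: inner_simps orth power2_eq_square)
  have S2: "S\<^sup>2 = 1 - C\<^sup>2" using CS by simp
  have f2: "f\<^sup>2 = a\<^sup>2 + b\<^sup>2 + 2 * a * b * C"
  proof -
    have "f\<^sup>2 = (x 3 - x 1) \<bullet> (x 3 - x 1)"
      unfolding f_def by (metis dist_commute dist_norm power2_norm_eq_inner)
    also have "\<dots> = (a + b * C)\<^sup>2 + b\<^sup>2 * S\<^sup>2" unfolding x13 nrm by (simp add: power_mult_distrib)
    finally show ?thesis unfolding S2 by (simp add: power2_eq_square algebra_simps)
  qed
  have e2: "e\<^sup>2 = a\<^sup>2 + b\<^sup>2 - 2 * a * b * C"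
  proof -
    have "e\<^sup>2 = (x 4 - x 2) \<bullet> (x 4 - x 2)"
      unfolding e_def by (metis dist_commute dist_norm power2_norm_eq_inner)
    also have "\<dots> = (b * C - a)\<^sup>2 + b\<^sup>2 * S\<^sup>2" unfolding x24 nrm by (simp add: power_mult_distrib)
    finally show ?thesis unfolding S2 by (simp add: power2_eq_square algebra_simps)
  qed
  have dir13: "direction (x 1) (x 3) = ((a + b * C) / f) *\<^sub>R u + (b * S / f) *\<^sub>R k"
    unfolding direction_def x13 f_def[symmetric]
    by (simp add: scaleR_add_right divide_inverse mult.commute)
  have dir24: "direction (x 2) (x 4) = ((b * C - a) / e) *\<^sub>R u + (b * S / e) *\<^sub>R k"
    unfolding direction_def x24 e_def[symmetric]
    by (simp add: scaleR_add_right divide_inverse mult.commute)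
  have dir14: "direction (x 1) (x 4) = C *\<^sub>R u + S *\<^sub>R k"
    using v unfolding direction_def x23 d14 b_def by simp
  have dir34: "direction (x 3) (x 4) = - u"
    using pos unfolding direction_def x34 d34 unfolding x12 by simp
  note uk = u_def[symmetric] k_def[symmetric]
  \<comment> \<open>Angle zero: up to phase the spinor of side 12 is \<open>F\<close>.\<close>
  obtain \<omega>\<^sub>1 where w1: "\<omega>\<^sub>1 * cnj \<omega>\<^sub>1 = 1"
    "\<alpha> 1 2 = \<omega>\<^sub>1 * (of_real 1 * A - of_real 0 * cnj B)" "\<beta> 1 2 = \<omega>\<^sub>1 * (of_real 1 * B + of_real 0 * cnj A)"
    by (rule phase_in_frame[OF AB(1) sp(1), of 1 0]) (use hp(1) AB(2) in simp_all)
  obtain c' s' \<omega>\<^sub>2 where cs': "c'\<^sup>2 + s'\<^sup>2 = (1::real)" "c'\<^sup>2 - s'\<^sup>2 = (a + b * C) / f" "2 * c' * s' = b * S / f"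
    and w2: "\<omega>\<^sub>2 * cnj \<omega>\<^sub>2 = 1"
    "\<alpha> 1 3 = \<omega>\<^sub>2 * (of_real c' * A - of_real s' * cnj B)" "\<beta> 1 3 = \<omega>\<^sub>2 * (of_real c' * B + of_real s' * cnj A)"
    by (rule spinor_in_frame[OF AB(1) sp(2), unfolded hp uk, OF dir13])
  \<comment> \<open>Sides 14 and 23 have equal directions, hence the same half-angle pair; only
    their phases may differ.\<close>
  obtain \<omega>\<^sub>3 where w3: "\<omega>\<^sub>3 * cnj \<omega>\<^sub>3 = 1"
    "\<alpha> 1 4 = \<omega>\<^sub>3 * (of_real c * A - of_real s * cnj B)" "\<beta> 1 4 = \<omega>\<^sub>3 * (of_real c * B + of_real s * cnj A)"
    by (rule phase_in_frame[OF AB(1) sp(3) cs, unfolded hp uk, OF dir14[unfolded C_def S_def]])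
  obtain \<omega>\<^sub>4 where w4: "\<omega>\<^sub>4 * cnj \<omega>\<^sub>4 = 1"
    "\<alpha> 2 3 = \<omega>\<^sub>4 * (of_real c * A - of_real s * cnj B)" "\<beta> 2 3 = \<omega>\<^sub>4 * (of_real c * B + of_real s * cnj A)"
    by (rule phase_in_frame[OF AB(1) sp(4) cs, unfolded hp uk, OF v[unfolded C_def S_def]])
  obtain c'' s'' \<omega>\<^sub>5 where cs'': "c''\<^sup>2 + s''\<^sup>2 = (1::real)" "c''\<^sup>2 - s''\<^sup>2 = (b * C - a) / e" "2 * c'' * s'' = b * S / e"
    and w5: "\<omega>\<^sub>5 * cnj \<omega>\<^sub>5 = 1"
    "\<alpha> 2 4 = \<omega>\<^sub>5 * (of_real c'' * A - of_real s'' * cnj B)" "\<beta> 2 4 = \<omega>\<^sub>5 * (of_real c'' * B + of_real s'' * cnj A)"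
    by (rule spinor_in_frame[OF AB(1) sp(5), unfolded hp uk, OF dir24])
  \<comment> \<open>The opposite direction has angle \<pi> and half-angle pair
    \<open>(0, 1)\<close>, which is \<open>J F\<close>.\<close>
  obtain \<omega>\<^sub>6 where w6: "\<omega>\<^sub>6 * cnj \<omega>\<^sub>6 = 1"
    "\<alpha> 3 4 = \<omega>\<^sub>6 * (of_real 0 * A - of_real 1 * cnj B)" "\<beta> 3 4 = \<omega>\<^sub>6 * (of_real 0 * B + of_real 1 * cnj A)"
    by (rule phase_in_frame[OF AB(1) sp(6), of 0 1]) (use hp(6) dir34 u_def in simp_all)
  define K where "K = ((s * s') * (s * s'') - (c * c') * (c * c''))\<^sup>2
      + ((c * s' + s * c') * (s * s'') + (c * c') * (c * s'' + s * c''))\<^sup>2"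
  have "det (atiyah_matrix \<alpha> \<beta>) = of_real K"
    unfolding K_def
    using det_atiyah_matrix_frame[OF AB(1), of \<alpha> \<beta> \<omega>\<^sub>1 \<omega>\<^sub>2 c' s' \<omega>\<^sub>3 c s \<omega>\<^sub>4 \<omega>\<^sub>5 c'' s'' \<omega>\<^sub>6]
      atiyah_lin_frame[where \<alpha> = \<alpha> and \<beta> = \<beta>, OF w1(2,3)] atiyah_lin_frame[where \<alpha> = \<alpha> and \<beta> = \<beta>, OF w2(2,3)]
      atiyah_lin_frame[where \<alpha> = \<alpha> and \<beta> = \<beta>, OF w3(2,3)] atiyah_lin_frame[where \<alpha> = \<alpha> and \<beta> = \<beta>, OF w4(2,3)]
      atiyah_lin_frame[where \<alpha> = \<alpha> and \<beta> = \<beta>, OF w5(2,3)] atiyah_lin_frame[where \<alpha> = \<alpha> and \<beta> = \<beta>, OF w6(2,3)]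
      w1(1) w2(1) w3(1) w4(1) w5(1) w6(1)
    by simp
  moreover have "(\<Prod>(i, j) \<in> pairs4. pdist x i j) = a * f * b * b * e * a"
    unfolding pairs4_eq using d14 d34 by (simp add: a_def b_def e_def f_def)
  ultimately have "D4 x \<alpha> \<beta> = of_real (64 * (a * f * b * b * e * a) * K)"
    unfolding D4_def by (simp only: of_real_mult)
  also have "64 * (a * f * b * b * e * a) * K = 64 * (a * f * b * b * e * a)
    + 8 * a * b * ((a + b - e) * (a + b - f))
      * (2 * (a + b)\<^sup>2 + 2 * (a + b) * (e + f) + e * f + (a - b)\<^sup>2)"
  proof (rule parallelogram_D4_value[OF f2 e2])
    show "4 * e * f * K = 2 * e * f + (a + b) * (e + f) + (a + b) * C * (e - f) + 2 * a * b * (1 - C\<^sup>2)"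
      unfolding K_def C_def
      by (rule parallelogram_det_value[OF cs cs'(1) cs''(1)])
        (use cs' cs'' pos in \<open>simp_all add: C_def S_def\<close>)
  qed
  finally show ?thesis .
qed

section \<open>Elementary inequalities for sides and diagonals\<close>

lemma parallelogram_dist:
  fixes p q r s :: "'a::real_inner"
  assumes "parallelogram p q r s"
  shows "dist r s = dist p q" "dist p s = dist q r"
    "(dist q s)\<^sup>2 + (dist p r)\<^sup>2 = 2 * ((dist p q)\<^sup>2 + (dist q r)\<^sup>2)"
proof -
  have s: "s = r - q + p" using assms by (simp add: parallelogram_def algebra_simps)
  show "dist r s = dist p q" "dist p s = dist q r"
    unfolding s dist_norm by (simp_all add: norm_minus_commute)
  show "(dist q s)\<^sup>2 + (dist p r)\<^sup>2 = 2 * ((dist p q)\<^sup>2 + (dist q r)\<^sup>2)"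
    unfolding s dist_norm power2_norm_eq_inner by (simp add: inner_simps inner_commute)
qed

context
  fixes a b e f :: real
  assumes pos: "a > 0" "b > 0" "e > 0" "f > 0"
    and law: "e\<^sup>2 + f\<^sup>2 = 2 * (a\<^sup>2 + b\<^sup>2)"
    and tri: "e \<le> a + b" "f \<le> a + b" "\<bar>a - b\<bar> \<le> e" "\<bar>a - b\<bar> \<le> f"
begin

abbreviation (input) "excess \<equiv> (a + b - e) * (a + b - f)"
abbreviation (input) "cofactor \<equiv> 2 * (a + b)\<^sup>2 + 2 * (a + b) * (e + f) + e * f + (a - b)\<^sup>2"

text \<open>The parallelogram law is \<open>e^2 + f^2 = (a + b)^2 + (a - b)^2\<close>, so
  \<open>e^2 - (a - b)^2 = (a + b)^2 - f^2\<close>. Bringing in the other diagonal makes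
  \<open>excess\<close> a factor of both values.\<close>

lemma d3_diagonals:
  "d3 a b e = (a + b - e) * ((a + b)\<^sup>2 - f\<^sup>2)"
  "d3 a b f = (a + b - f) * ((a + b)\<^sup>2 - e\<^sup>2)"
proof -
  have "d3 a b g = (a + b - g) * (g\<^sup>2 - (a - b)\<^sup>2)" for g
    by (simp add: d3_def power2_eq_square algebra_simps)
  moreover have "e\<^sup>2 - (a - b)\<^sup>2 = (a + b)\<^sup>2 - f\<^sup>2" "f\<^sup>2 - (a - b)\<^sup>2 = (a + b)\<^sup>2 - e\<^sup>2"
    using law by (simp_all add: power2_eq_square algebra_simps)
  ultimately show "d3 a b e = (a + b - e) * ((a + b)\<^sup>2 - f\<^sup>2)"
    "d3 a b f = (a + b - f) * ((a + b)\<^sup>2 - e\<^sup>2)" by simp_all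
qed

lemma d3_nonneg: "d3 a b e \<ge> 0" "d3 a b f \<ge> 0"
  using tri unfolding d3_def by (auto intro!: mult_nonneg_nonneg)

text \<open>Each factor is at most \<open>a + b - |a - b|\<close>, whose square is at most
  \<open>(a + b)^2 - (a - b)^2\<close>. The upper bound serves the product of the two
  \<open>d3\<close> values, where \<open>excess\<close> occurs squared.\<close>

lemma excess_bounds: "0 \<le> excess" "excess \<le> 4 * a * b"
proof -
  show "0 \<le> excess" using tri by simp
  have "excess \<le> (a + b - \<bar>a - b\<bar>) * (a + b - \<bar>a - b\<bar>)"
    using tri by (intro mult_mono) auto
  also have "\<dots> \<le> (a + b - \<bar>a - b\<bar>) * (a + b + \<bar>a - b\<bar>)"
    using pos by (intro mult_left_mono) auto
  also have "\<dots> = (a + b)\<^sup>2 - \<bar>a - b\<bar>\<^sup>2" by (simp add: power2_eq_square algebra_simps)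
  also have "\<dots> = 4 * a * b" unfolding power2_abs by (simp add: power2_eq_square algebra_simps)
  finally show "excess \<le> 4 * a * b" .
qed

text \<open>This combination occurs both in the sum over the four vertices and in the mixed terms of
  the product over triples.\<close>

lemma d3_cross: "f * d3 a b e + e * d3 a b f = excess * ((a + b) * (e + f) + (a + b)\<^sup>2 + (a - b)\<^sup>2)"
proof -
  have "f * d3 a b e + e * d3 a b f = excess * ((a + b) * (e + f) + (e\<^sup>2 + f\<^sup>2))"
    unfolding d3_diagonals by (simp add: power2_eq_square algebra_simps)
  also have "e\<^sup>2 + f\<^sup>2 = (a + b)\<^sup>2 + (a - b)\<^sup>2"
    unfolding law by (simp add: power2_eq_square algebra_simps)
  finally show ?thesis by (simp only: add.assoc)
qed

text \<open>After cancelling \<open>a b excess / 2\<close>, right minus left is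
  \<open>15 m + 15 p + 16 g - q\<close> with \<open>m = (a + b)(e + f)\<close>,
  \<open>p = (a + b)^2\<close>, \<open>g = e f\<close> and \<open>q = (a - b)^2\<close>; it is
  nonnegative because \<open>q \<le> p\<close>.\<close>

lemma strong_four_points_bound:
  "2 * (17/4) * a * b * (f * d3 a b e + e * d3 a b f) \<le> 8 * a * b * excess * cofactor"
proof -
  have "(a - b)\<^sup>2 \<le> (a + b)\<^sup>2" using pos by (simp add: power2_eq_square algebra_simps)
  moreover have "0 \<le> (a + b)\<^sup>2" "0 \<le> (a + b) * (e + f)" "0 \<le> e * f" using pos by auto
  moreover have "17 * (m + p + q) \<le> 16 * (2 * p + 2 * m + g + q)"
    if "q \<le> p" "0 \<le> p" "0 \<le> m" "0 \<le> g" for m p q g :: real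
    using that by (simp add: algebra_simps)
  ultimately have "17 * ((a + b) * (e + f) + (a + b)\<^sup>2 + (a - b)\<^sup>2) \<le> 16 * cofactor"
    unfolding mult.assoc[of 2] by blast
  then have "a * b * excess * (17 * ((a + b) * (e + f) + (a + b)\<^sup>2 + (a - b)\<^sup>2)) \<le> a * b * excess * (16 * cofactor)"
    using pos excess_bounds(1) by (intro mult_left_mono) auto
  moreover have "2 * (17/4) * a * b * (t * v) \<le> 8 * a * b * t * w"
    if "a * b * t * (17 * v) \<le> a * b * t * (16 * w)" for t v w :: real
    using that by (simp add: algebra_simps)
  ultimately show ?thesis unfolding d3_cross by blast
qed

lemma d3_product_bound:
  "(d3 a b e + 8 * a * b * e) * (d3 a b f + 8 * a * b * f) \<le> 64 * a\<^sup>2 * b\<^sup>2 * e * f + 8 * a * b * excess * cofactor"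
proof -
  define R where "R = (a + b + e) * (a + b + f)"
  have "d3 a b e * d3 a b f = excess * (excess * R)"
    unfolding d3_diagonals R_def by (simp add: power2_eq_square algebra_simps)
  also have "\<dots> \<le> excess * (4 * a * b * R)"
    using pos excess_bounds unfolding R_def by (intro mult_left_mono mult_right_mono) auto
  \<comment> \<open>The factor 2 is given away on purpose: with \<open>8 a b\<close> the term
    \<open>R\<close> joins the mixed terms, and together they give exactly
    \<open>cofactor\<close>.\<close>
  also have "\<dots> \<le> excess * (8 * a * b * R)"
    using pos excess_bounds(1) unfolding R_def by (intro mult_left_mono mult_right_mono) auto
  finally have "d3 a b e * d3 a b f + 8 * a * b * (f * d3 a b e + e * d3 a b f)
      \<le> 8 * a * b * excess * (R + (a + b) * (e + f) + (a + b)\<^sup>2 + (a - b)\<^sup>2)"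
    unfolding d3_cross by (simp add: algebra_simps)
  also have "R + (a + b) * (e + f) + (a + b)\<^sup>2 + (a - b)\<^sup>2 = cofactor"
    unfolding R_def by (simp add: power2_eq_square algebra_simps)
  finally show ?thesis by (simp add: power2_eq_square algebra_simps)
qed

end

section \<open>The three inequalities deduced from the closed form\<close>

theorem mainTheorem1:
  fixes x :: "nat \<Rightarrow> real^3"
    and \<alpha> \<beta> :: "nat \<Rightarrow> nat \<Rightarrow> complex"
  assumes distinct: "inj_on x {1..4}"
    and parallelogram: "parallelogram (x 1) (x 2) (x 3) (x 4)"
    and choice: "atiyah_choice x \<alpha> \<beta>"
  shows
    "cmod (D4 x \<alpha> \<beta>) \<ge> 64 * (\<Prod>(i, j) \<in> pairs4. pdist x i j)
     \<and>
     (cmod (D4 x \<alpha> \<beta>))\<^sup>2 \<ge>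
       (\<Prod>(i, j, k) \<in> triples4.
          d3 (pdist x i j) (pdist x i k) (pdist x j k) + 8 * pdist x i j * pdist x i k * pdist x j k)
     \<and>
     Re (D4 x \<alpha> \<beta>) \<ge>
       64 * (\<Prod>(i, j) \<in> pairs4. pdist x i j) +
       (\<Sum>(l, i, j, k) \<in> {(l, i, j, k). l \<in> {1..4} \<and> i < j \<and> j < k \<and> {i, j, k} = {1..4} - {l}}.
          (4 + 1/4) * pdist x i l * pdist x j l * pdist x k l *
          d3 (pdist x i j) (pdist x i k) (pdist x j k))"
proof -
  define a b e f where "a = pdist x 1 2" and "b = pdist x 2 3" and "e = pdist x 2 4" and "f = pdist x 1 3"
  note defs = a_def b_def e_def f_def
  have ne: "x i \<noteq> x j" if "(i, j) \<in> pairs4" for i j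
    using that inj_onD[OF distinct, of i j] by auto
  have pos: "a > 0" "b > 0" "e > 0" "f > 0"
    using ne unfolding defs by auto
  note sides = parallelogram_dist[OF parallelogram, folded defs]
  have law: "e\<^sup>2 + f\<^sup>2 = 2 * (a\<^sup>2 + b\<^sup>2)" by (rule sides(3))
  have tri: "e \<le> a + b" "f \<le> a + b" "\<bar>a - b\<bar> \<le> e" "\<bar>a - b\<bar> \<le> f"
    using dist_triangle[of "x 2" "x 4" "x 3"] dist_triangle[of "x 1" "x 3" "x 2"]
      dist_triangle[of "x 2" "x 3" "x 4"] dist_triangle[of "x 3" "x 4" "x 2"]
      dist_triangle[of "x 1" "x 2" "x 3"] dist_triangle[of "x 2" "x 3" "x 1"]
    using sides by (auto simp: defs dist_commute)
  note bounds = pos law tri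
  \<comment> \<open>The surplus over 64 times the product of distances: (C2) amounts to
    \<open>E \<ge> 0\<close>, and the strong inequality bounds the weighted sum by
    \<open>E\<close>.\<close>
  define E where "E = 8 * a * b * ((a + b - e) * (a + b - f))
      * (2 * (a + b)\<^sup>2 + 2 * (a + b) * (e + f) + e * f + (a - b)\<^sup>2)"
  define D where "D = 64 * (a * f * b * b * e * a) + E"
  have D4: "D4 x \<alpha> \<beta> = of_real D"
    unfolding D_def E_def defs by (rule D4_parallelogram[OF distinct parallelogram choice])
  have E: "E \<ge> 0" unfolding E_def using pos excess_bounds(1)[OF bounds] by auto
  have D: "D \<ge> 0" unfolding D_def using pos E by auto
  have prod: "(\<Prod>(i, j) \<in> pairs4. pdist x i j) = a * f * b * b * e * a"
    unfolding pairs4_eq using sides(1,2) by (simp add: defs)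
  \<comment> \<open>The diagonals cut the parallelogram into two pairs of congruent triangles, with
    sides \<open>a, b, e\<close> and \<open>a, b, f\<close>. The product over triples is thus a
    square, and (C3) reduces to \<open>M1 M2 \<le> D\<close>.\<close>
  define M1 M2 where "M1 = d3 a b e + 8 * a * b * e" and "M2 = d3 a b f + 8 * a * b * f"
  have "(\<Prod>(i, j, k) \<in> triples4.
      d3 (pdist x i j) (pdist x i k) (pdist x j k) + 8 * pdist x i j * pdist x i k * pdist x j k)
    = (d3 a f b + 8 * a * f * b) * (d3 a b e + 8 * a * b * e) * (d3 f b a + 8 * f * b * a)
      * (d3 b e a + 8 * b * e * a)"
    unfolding triples4_eq using sides(1,2) by (simp add: defs)
  also have "\<dots> = (M1 * M2)\<^sup>2"
  proof -
    have "d3 a f b = d3 a b f" "d3 f b a = d3 a b f" "d3 b e a = d3 a b e"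
      by (simp_all add: d3_def algebra_simps)
    then show ?thesis by (simp add: M1_def M2_def power2_eq_square ac_simps)
  qed
  also have "\<dots> \<le> D\<^sup>2"
  proof (rule power_mono)
    show "M1 * M2 \<le> D"
      using d3_product_bound[OF bounds]
      unfolding M1_def M2_def D_def E_def by (simp add: power2_eq_square ac_simps)
    show "0 \<le> M1 * M2"
      unfolding M1_def M2_def using pos d3_nonneg[OF bounds] by (auto intro!: mult_nonneg_nonneg add_nonneg_nonneg)
  qed
  finally have C3: "(\<Prod>(i, j, k) \<in> triples4.
      d3 (pdist x i j) (pdist x i k) (pdist x j k) + 8 * pdist x i j * pdist x i k * pdist x j k) \<le> D\<^sup>2" .
  \<comment> \<open>The edges at a vertex are \<open>a\<close>, \<open>b\<close> and the diagonal
    through it, while the opposite face contains the other diagonal; each combination occurs at two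
    vertices.\<close>
  have "(\<Sum>(l, i, j, k) \<in> {(l, i, j, k). l \<in> {1..4} \<and> i < j \<and> j < k \<and> {i, j, k} = {1..4} - {l}}.
      (4 + 1/4) * pdist x i l * pdist x j l * pdist x k l * d3 (pdist x i j) (pdist x i k) (pdist x j k))
    = (17/4) * a * f * b * d3 b e a + (17/4) * a * b * e * d3 f b a
      + (17/4) * f * b * a * d3 a b e + (17/4) * b * e * a * d3 a f b"
    unfolding opposite_triples4_eq using sides(1,2) by (simp add: defs dist_commute)
  also have "\<dots> = 2 * (17/4) * a * b * (f * d3 a b e + e * d3 a b f)"
  proof -
    have "d3 a f b = d3 a b f" "d3 f b a = d3 a b f" "d3 b e a = d3 a b e"
      by (simp_all add: d3_def algebra_simps)
    then show ?thesis by (simp add: algebra_simps)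
  qed
  also have "\<dots> \<le> E" unfolding E_def by (rule strong_four_points_bound[OF bounds])
  finally have strong: "(\<Sum>(l, i, j, k) \<in> {(l, i, j, k). l \<in> {1..4} \<and> i < j \<and> j < k \<and> {i, j, k} = {1..4} - {l}}.
      (4 + 1/4) * pdist x i l * pdist x j l * pdist x k l * d3 (pdist x i j) (pdist x i k) (pdist x j k)) \<le> E" .
  \<comment> \<open>The determinant is a nonnegative real, so modulus and real part
    coincide.\<close>
  have "cmod (D4 x \<alpha> \<beta>) = D" "Re (D4 x \<alpha> \<beta>) = D" using D by (simp_all add: D4)
  moreover have "64 * (a * f * b * b * e * a) \<le> D" using E by (simp add: D_def)
  ultimately show ?thesis
    unfolding prod using C3 add_left_mono[OF strong] by (simp only: D_def simp_thms)
qed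

end
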